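(* Let $\Sigma=\mathcal{M}/\!\sim$ be the set of M-equivalence classes of real matrices of arbitrary finite dimensions, with the product $\langle A\rangle\ltimes\langle B\rangle:=\langle A\ltimes B\rangle$. Then $(\Sigma,\ltimes)$ is a monoid.
   Context: $\mathcal{M}_{m\times n}$: real $m\times n$ matrices, $\mathcal{M}=\bigcup_{m,n\ge1}\mathcal{M}_{m\times n}$; $\otimes$ is the Kronecker product. M-product: for $A\in\mathcal{M}_{m\times n}$, $B\in\mathcal{M}_{p\times q}$, $t=\operatorname{lcm}(n,p)$: $A\ltimes B:=(A\otimes I_{t/n})(B\otimes I_{t/p})$. M-equivalence: $A\sim B$ if there exist $\alpha,\beta\in\mathbb{N}=\{1,2,\dots\}$ such that $A\otimes I_\alpha=B\otimes I_\beta$. This is an equivalence relation; $\langle A\rangle$ denotes the class of $A$, and the product on classes does not depend on the choice of representatives. A monoid is a set with an associative binary operation having a two-sided identity. *)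

theory Defs
  imports "Jordan_Normal_Form.Matrix"
begin

definition M_mats :: "real mat set" where
  "M_mats = (\<Union>m\<in>{1..}. \<Union>n\<in>{1..}. carrier_mat m n)"

text \<open>Kronecker product, with matrix indices starting at 0.\<close>

definition kron :: "real mat \<Rightarrow> real mat \<Rightarrow> real mat" (infixl \<open>\<otimes>\<^sub>K\<close> 75) where
  "A \<otimes>\<^sub>K B = mat (dim_row A * dim_row B) (dim_col A * dim_col B)
     (\<lambda>(i, j). A $$ (i div dim_row B, j div dim_col B) * B $$ (i mod dim_row B, j mod dim_col B))"

definition M_prod :: "real mat \<Rightarrow> real mat \<Rightarrow> real mat" (infixl \<open>\<times>\<^sub>M\<close> 70) where
  "A \<times>\<^sub>M B = (let n = dim_col A; p = dim_row B; t = lcm n p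
     in (A \<otimes>\<^sub>K 1\<^sub>m (t div n)) * (B \<otimes>\<^sub>K 1\<^sub>m (t div p)))"

definition M_equiv :: "(real mat \<times> real mat) set" where
  "M_equiv = {(A, B). A \<in> M_mats \<and> B \<in> M_mats \<and>
     (\<exists>\<alpha>\<ge>1. \<exists>\<beta>\<ge>1. A \<otimes>\<^sub>K 1\<^sub>m \<alpha> = B \<otimes>\<^sub>K 1\<^sub>m \<beta>)}"

definition M_class :: "real mat \<Rightarrow> real mat set" where
  "M_class A = M_equiv `` {A}"

definition Sigma_M :: "real mat set set" where
  "Sigma_M = M_mats // M_equiv"

text \<open>
  The union runs over all representatives of the two classes; it is the single class of
  \<open>A \<times>\<^sub>M B\<close> because the product respects \<open>M_equiv\<close> (lemma \<open>M_class_prod_eq\<close> below).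
\<close>

definition M_class_prod :: "real mat set \<Rightarrow> real mat set \<Rightarrow> real mat set" where
  "M_class_prod X Y = (\<Union>A\<in>X. \<Union>B\<in>Y. M_class (A \<times>\<^sub>M B))"

lemma M_mats_iff: "A \<in> M_mats \<longleftrightarrow> 0 < dim_row A \<and> 0 < dim_col A"
proof -
  have "A \<in> M_mats \<longleftrightarrow> 1 \<le> dim_row A \<and> 1 \<le> dim_col A"
    unfolding M_mats_def carrier_mat_def by blast
  then show ?thesis by linarith
qed

lemma kron_dim [simp]:
  "dim_row (A \<otimes>\<^sub>K B) = dim_row A * dim_row B"
  "dim_col (A \<otimes>\<^sub>K B) = dim_col A * dim_col B"
  by (simp_all add: kron_def)

lemma kron_one_one: "1\<^sub>m a \<otimes>\<^sub>K 1\<^sub>m b = 1\<^sub>m (a * b)"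
proof (rule eq_matI)
  fix i j assume "i < dim_row (1\<^sub>m (a * b) :: real mat)" "j < dim_col (1\<^sub>m (a * b) :: real mat)"
  then have ij: "i < a * b" "j < a * b" by simp_all
  then have b: "b > 0" by (cases b) auto
  have "i div b < a" "j div b < a" using ij by (simp_all add: less_mult_imp_div_less)
  moreover have "i = j \<longleftrightarrow> i div b = j div b \<and> i mod b = j mod b"
    using div_mult_mod_eq [of i b] div_mult_mod_eq [of j b] by metis
  ultimately show "(1\<^sub>m a \<otimes>\<^sub>K 1\<^sub>m b) $$ (i, j) = 1\<^sub>m (a * b) $$ (i, j)"
    using ij b by (auto simp: kron_def)
qed simp_all

lemma kron_assoc: "(A \<otimes>\<^sub>K B) \<otimes>\<^sub>K C = A \<otimes>\<^sub>K (B \<otimes>\<^sub>K C)"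
proof -
  have *: "i mod (b * c) div c = i div c mod b" "i mod (b * c) mod c = i mod c"
      "i div (b * c) = i div c div b" if "0 < c" for i b c :: nat
    using that by (simp_all add: mod_mult2_eq div_mult2_eq mult.commute [of b c])
  show ?thesis
  proof (rule eq_matI)
    fix i j
    assume "i < dim_row (A \<otimes>\<^sub>K (B \<otimes>\<^sub>K C))" "j < dim_col (A \<otimes>\<^sub>K (B \<otimes>\<^sub>K C))"
    then have ij: "i < dim_row A * dim_row B * dim_row C" "j < dim_col A * dim_col B * dim_col C"
      by (simp_all add: mult.assoc)
    then have pos: "0 < dim_row B" "0 < dim_row C" "0 < dim_col B" "0 < dim_col C"
      by (auto intro: gr0I)
    from ij have d: "i div dim_row C < dim_row A * dim_row B"
        "j div dim_col C < dim_col A * dim_col B"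
      by (simp_all add: less_mult_imp_div_less)
    show "(A \<otimes>\<^sub>K B \<otimes>\<^sub>K C) $$ (i, j) = (A \<otimes>\<^sub>K (B \<otimes>\<^sub>K C)) $$ (i, j)"
      using ij d pos by (simp add: kron_def * mult.assoc)
  qed (simp_all add: mult.assoc)
qed

lemma kron_ones: "A \<otimes>\<^sub>K 1\<^sub>m a \<otimes>\<^sub>K 1\<^sub>m b = A \<otimes>\<^sub>K 1\<^sub>m (a * b)"
  by (simp add: kron_assoc kron_one_one)

lemma sum_div_mod:
  fixes f :: "nat \<Rightarrow> nat \<Rightarrow> real"
  assumes "0 < s"
  shows "(\<Sum>k<n * s. f (k div s) (k mod s)) = (\<Sum>q<n. \<Sum>r<s. f q r)"
proof -
  have "(\<Sum>k = q * s..<q * s + s. f (k div s) (k mod s)) = (\<Sum>r<s. f q r)" for q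
    using sum.shift_bounds_nat_ivl [of "\<lambda>k. f (k div s) (k mod s)" 0 "q * s" s] assms
    by (simp add: add.commute atLeast0LessThan)
  then show ?thesis
    by (simp only: sum.nat_group [symmetric])
qed

lemma kron_one_mult:
  assumes "dim_col A = dim_row B" "0 < s"
  shows "(A \<otimes>\<^sub>K 1\<^sub>m s) * (B \<otimes>\<^sub>K 1\<^sub>m s) = (A * B) \<otimes>\<^sub>K 1\<^sub>m s"
proof (rule eq_matI)
  fix i j
  assume "i < dim_row ((A * B) \<otimes>\<^sub>K 1\<^sub>m s)" "j < dim_col ((A * B) \<otimes>\<^sub>K 1\<^sub>m s)"
  then have ij: "i < dim_row A * s" "j < dim_col B * s" by simp_all
  then have d: "i div s < dim_row A" "j div s < dim_col B"
    by (simp_all add: less_mult_imp_div_less)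
  let ?n = "dim_row B"
  have "((A \<otimes>\<^sub>K 1\<^sub>m s) * (B \<otimes>\<^sub>K 1\<^sub>m s)) $$ (i, j)
      = (\<Sum>k<?n * s. (A \<otimes>\<^sub>K 1\<^sub>m s) $$ (i, k) * (B \<otimes>\<^sub>K 1\<^sub>m s) $$ (k, j))"
    using ij assms by (simp add: scalar_prod_def atLeast0LessThan)
  also have "\<dots> = (\<Sum>k<?n * s. A $$ (i div s, k div s) * (if i mod s = k mod s then 1 else 0)
      * (B $$ (k div s, j div s) * (if k mod s = j mod s then 1 else 0)))"
    using ij assms by (intro sum.cong refl) (simp add: kron_def)
  also have "\<dots> = (\<Sum>q<?n. \<Sum>r<s. A $$ (i div s, q) * (if i mod s = r then 1 else 0)
      * (B $$ (q, j div s) * (if r = j mod s then 1 else 0)))"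
    by (rule sum_div_mod [OF assms(2)])
  also have "\<dots> = (\<Sum>q<?n. A $$ (i div s, q) * B $$ (q, j div s)
      * (if i mod s = j mod s then 1 else 0))"
  proof (intro sum.cong refl)
    fix q
    have "(\<Sum>r<s. A $$ (i div s, q) * (if i mod s = r then 1 else 0)
        * (B $$ (q, j div s) * (if r = j mod s then 1 else 0)))
      = (\<Sum>r<s. if i mod s = r then A $$ (i div s, q) * B $$ (q, j div s)
        * (if i mod s = j mod s then 1 else 0) else 0)"
      by (intro sum.cong refl) auto
    also have "\<dots> = A $$ (i div s, q) * B $$ (q, j div s) * (if i mod s = j mod s then 1 else 0)"
      using assms(2) by simp
    finally show "(\<Sum>r<s. A $$ (i div s, q) * (if i mod s = r then 1 else 0)
        * (B $$ (q, j div s) * (if r = j mod s then 1 else 0)))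
      = A $$ (i div s, q) * B $$ (q, j div s) * (if i mod s = j mod s then 1 else 0)" .
  qed
  also have "\<dots> = ((A * B) \<otimes>\<^sub>K 1\<^sub>m s) $$ (i, j)"
    using ij d assms
    by (simp add: kron_def scalar_prod_def atLeast0LessThan)
  finally show "((A \<otimes>\<^sub>K 1\<^sub>m s) * (B \<otimes>\<^sub>K 1\<^sub>m s)) $$ (i, j) = ((A * B) \<otimes>\<^sub>K 1\<^sub>m s) $$ (i, j)" .
qed simp_all

lemma M_prod_common:
  assumes "A \<in> M_mats" "B \<in> M_mats" "0 < s" "dim_col A dvd s" "dim_row B dvd s"
  shows "(A \<otimes>\<^sub>K 1\<^sub>m (s div dim_col A)) * (B \<otimes>\<^sub>K 1\<^sub>m (s div dim_row B))
    = (A \<times>\<^sub>M B) \<otimes>\<^sub>K 1\<^sub>m (s div lcm (dim_col A) (dim_row B))"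
proof -
  define t where "t = lcm (dim_col A) (dim_row B)"
  obtain u where u: "s = t * u"
    using assms(4,5) unfolding t_def by (meson dvdE lcm_least)
  have pos: "0 < dim_col A" "0 < dim_row B" using assms by (simp_all add: M_mats_iff)
  then have tu: "0 < t" "0 < u" using assms(3) u by (auto simp: t_def lcm_pos_nat)
  have d: "dim_col A dvd t" "dim_row B dvd t" by (simp_all add: t_def)
  then have "s div dim_col A = t div dim_col A * u" "s div dim_row B = t div dim_row B * u"
    by (simp_all add: u div_mult_swap mult.commute)
  then have "(A \<otimes>\<^sub>K 1\<^sub>m (s div dim_col A)) * (B \<otimes>\<^sub>K 1\<^sub>m (s div dim_row B))
    = (A \<otimes>\<^sub>K 1\<^sub>m (t div dim_col A) \<otimes>\<^sub>K 1\<^sub>m u) * (B \<otimes>\<^sub>K 1\<^sub>m (t div dim_row B) \<otimes>\<^sub>K 1\<^sub>m u)"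
    by (simp only: kron_ones)
  also have "\<dots> = ((A \<otimes>\<^sub>K 1\<^sub>m (t div dim_col A)) * (B \<otimes>\<^sub>K 1\<^sub>m (t div dim_row B))) \<otimes>\<^sub>K 1\<^sub>m u"
    using d by (intro kron_one_mult tu) simp
  also have "\<dots> = (A \<times>\<^sub>M B) \<otimes>\<^sub>K 1\<^sub>m u"
    by (simp only: M_prod_def Let_def t_def)
  also have "u = s div t" using u tu by simp
  finally show ?thesis by (simp only: t_def)
qed

lemma M_mats_kron_one: "A \<in> M_mats \<Longrightarrow> 0 < a \<Longrightarrow> A \<otimes>\<^sub>K 1\<^sub>m a \<in> M_mats"
  by (simp add: M_mats_iff)

lemma M_prod_closed:
  assumes "A \<in> M_mats" "B \<in> M_mats"
  shows "A \<times>\<^sub>M B \<in> M_mats"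
proof -
  define t where "t = lcm (dim_col A) (dim_row B)"
  have pos: "0 < dim_row A" "0 < dim_col A" "0 < dim_row B" "0 < dim_col B"
    using assms by (simp_all add: M_mats_iff)
  then have "0 < t" "dim_col A dvd t" "dim_row B dvd t" by (simp_all add: t_def lcm_pos_nat)
  with pos have "0 < t div dim_col A" "0 < t div dim_row B"
    by (simp_all add: div_greater_zero_iff dvd_imp_le)
  with pos show ?thesis
    unfolding M_prod_def Let_def t_def [symmetric] M_mats_iff by simp
qed

lemma M_equivI:
  assumes "A \<in> M_mats" "B \<in> M_mats" "0 < a" "0 < b" "A \<otimes>\<^sub>K 1\<^sub>m a = B \<otimes>\<^sub>K 1\<^sub>m b"
  shows "(A, B) \<in> M_equiv"
proof -
  have "1 \<le> a" "1 \<le> b" using assms(3,4) by simp_all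
  then show ?thesis using assms unfolding M_equiv_def by blast
qed

lemma M_equivE:
  assumes "(A, B) \<in> M_equiv"
  obtains a b where "A \<in> M_mats" "B \<in> M_mats" "0 < a" "0 < b" "A \<otimes>\<^sub>K 1\<^sub>m a = B \<otimes>\<^sub>K 1\<^sub>m b"
proof -
  from assms obtain a b where
    "A \<in> M_mats" "B \<in> M_mats" "1 \<le> a" "1 \<le> b" "A \<otimes>\<^sub>K 1\<^sub>m a = B \<otimes>\<^sub>K 1\<^sub>m b"
    unfolding M_equiv_def by blast
  then show ?thesis by (intro that [of a b]) simp_all
qed

lemma M_equiv_equiv: "equiv M_mats M_equiv"
proof (rule equivI)
  show "M_equiv \<subseteq> M_mats \<times> M_mats" by (auto simp: M_equiv_def)
  show "refl_on M_mats M_equiv" by (auto simp: refl_on_def M_equiv_def)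
  show "sym M_equiv" unfolding sym_def M_equiv_def by (auto; metis)
  show "trans M_equiv"
  proof (rule transI)
    fix A B C assume "(A, B) \<in> M_equiv" "(B, C) \<in> M_equiv"
    then obtain a b c d where
      h: "A \<in> M_mats" "C \<in> M_mats" "1 \<le> a" "1 \<le> b" "1 \<le> c" "1 \<le> d"
        "A \<otimes>\<^sub>K 1\<^sub>m a = B \<otimes>\<^sub>K 1\<^sub>m b" "B \<otimes>\<^sub>K 1\<^sub>m c = C \<otimes>\<^sub>K 1\<^sub>m d"
      by (auto simp: M_equiv_def)
    have "A \<otimes>\<^sub>K 1\<^sub>m (a * c) = B \<otimes>\<^sub>K 1\<^sub>m (c * b)"
      by (metis h(7) kron_ones mult.commute)
    also have "\<dots> = C \<otimes>\<^sub>K 1\<^sub>m (d * b)"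
      by (metis h(8) kron_ones)
    finally have "A \<otimes>\<^sub>K 1\<^sub>m (a * c) = C \<otimes>\<^sub>K 1\<^sub>m (d * b)" .
    moreover have "0 < a * c" "0 < d * b" using h by simp_all
    ultimately show "(A, C) \<in> M_equiv" using h(1,2) by (intro M_equivI)
  qed
qed

lemma kron_one_1: "A \<otimes>\<^sub>K 1\<^sub>m 1 = A"
  by (rule eq_matI) (auto simp: kron_def)

lemma M_prod_kron_equiv:
  assumes "A \<in> M_mats" "B \<in> M_mats" "0 < a" "0 < b"
  shows "(A \<times>\<^sub>M B, (A \<otimes>\<^sub>K 1\<^sub>m a) \<times>\<^sub>M (B \<otimes>\<^sub>K 1\<^sub>m b)) \<in> M_equiv"
proof -
  define s where "s = lcm (dim_col A * a) (dim_row B * b)"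
  have pos: "0 < dim_col A" "0 < dim_row B" using assms by (simp_all add: M_mats_iff)
  then have s: "0 < s" using assms by (simp add: s_def lcm_pos_nat)
  have dvd: "dim_col A * a dvd s" "dim_row B * b dvd s" by (simp_all add: s_def)
  then have dvd': "dim_col A dvd s" "dim_row B dvd s" by (auto dest: dvd_mult_left)
  have cancel: "y * (s div (x * y)) = s div x" if "x * y dvd s" "0 < x" "0 < y" for x y
  proof -
    obtain k where "s = x * y * k" using \<open>x * y dvd s\<close> by (rule dvdE)
    with \<open>0 < x\<close> \<open>0 < y\<close> show ?thesis by (simp add: mult.assoc)
  qed
  have "a * (s div (dim_col A * a)) = s div dim_col A" "b * (s div (dim_row B * b)) = s div dim_row B"
    using cancel dvd assms(3,4) pos by blast+
  then have "(A \<otimes>\<^sub>K 1\<^sub>m a) \<times>\<^sub>M (B \<otimes>\<^sub>K 1\<^sub>m b)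
      = (A \<otimes>\<^sub>K 1\<^sub>m (s div dim_col A)) * (B \<otimes>\<^sub>K 1\<^sub>m (s div dim_row B))"
    by (simp add: M_prod_def Let_def s_def [symmetric] kron_ones)
  also have "\<dots> = (A \<times>\<^sub>M B) \<otimes>\<^sub>K 1\<^sub>m (s div lcm (dim_col A) (dim_row B))"
    by (rule M_prod_common [OF assms(1,2) s dvd'])
  finally have eq: "(A \<times>\<^sub>M B) \<otimes>\<^sub>K 1\<^sub>m (s div lcm (dim_col A) (dim_row B))
      = ((A \<otimes>\<^sub>K 1\<^sub>m a) \<times>\<^sub>M (B \<otimes>\<^sub>K 1\<^sub>m b)) \<otimes>\<^sub>K 1\<^sub>m 1"
    by (simp only: kron_one_1)
  have "lcm (dim_col A) (dim_row B) dvd s" using dvd' by simp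
  then have "0 < s div lcm (dim_col A) (dim_row B)"
    using s pos by (simp add: div_greater_zero_iff dvd_imp_le lcm_pos_nat)
  moreover have "A \<times>\<^sub>M B \<in> M_mats" "(A \<otimes>\<^sub>K 1\<^sub>m a) \<times>\<^sub>M (B \<otimes>\<^sub>K 1\<^sub>m b) \<in> M_mats"
    using assms by (simp_all add: M_prod_closed M_mats_kron_one)
  ultimately show ?thesis
    using eq by (intro M_equivI [where b = 1]) simp_all
qed

lemma M_prod_respects:
  assumes "(A, A') \<in> M_equiv" "(B, B') \<in> M_equiv"
  shows "(A \<times>\<^sub>M B, A' \<times>\<^sub>M B') \<in> M_equiv"
proof -
  obtain a a' b b' where
    h: "A \<in> M_mats" "A' \<in> M_mats" "B \<in> M_mats" "B' \<in> M_mats" "0 < a" "0 < a'" "0 < b" "0 < b'"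
      and eq: "A \<otimes>\<^sub>K 1\<^sub>m a = A' \<otimes>\<^sub>K 1\<^sub>m a'" "B \<otimes>\<^sub>K 1\<^sub>m b = B' \<otimes>\<^sub>K 1\<^sub>m b'"
    using M_equivE [OF assms(1)] M_equivE [OF assms(2)] by metis
  have "(A \<times>\<^sub>M B, (A \<otimes>\<^sub>K 1\<^sub>m a) \<times>\<^sub>M (B \<otimes>\<^sub>K 1\<^sub>m b)) \<in> M_equiv"
    using h by (intro M_prod_kron_equiv)
  moreover have "(A' \<times>\<^sub>M B', (A \<otimes>\<^sub>K 1\<^sub>m a) \<times>\<^sub>M (B \<otimes>\<^sub>K 1\<^sub>m b)) \<in> M_equiv"
    unfolding eq using h by (intro M_prod_kron_equiv)
  ultimately show ?thesis
    using M_equiv_equiv by (meson equivE symD transD)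
qed

lemma M_class_prod_eq:
  assumes "A \<in> M_mats" "B \<in> M_mats"
  shows "M_class_prod (M_class A) (M_class B) = M_class (A \<times>\<^sub>M B)"
  unfolding M_class_prod_def M_class_def
proof (rule UN_equiv_class2 [OF M_equiv_equiv M_equiv_equiv _ assms])
  show "congruent2 M_equiv M_equiv (\<lambda>A B. M_equiv `` {A \<times>\<^sub>M B})"
    by (auto intro!: congruent2I' equiv_class_eq [OF M_equiv_equiv] M_prod_respects)
qed

end

theory Submission
  imports Defs
begin

text \<open>
  On matrices with matching inner dimensions the M-product is the ordinary matrix product, and
  tensoring with an identity matrix scales the dimensions of a matrix without leaving its class.
  For \<open>A\<close>, \<open>B\<close>, \<open>C\<close> of sizes \<open>m \<times> n\<close>, \<open>p \<times> q\<close>, \<open>r \<times> s\<close>, the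
  representatives \<open>A \<otimes> I\<close>, \<open>B \<otimes> I\<close>, \<open>C \<otimes> I\<close> with identities of orders
  \<open>p r\<close>, \<open>n r\<close>, \<open>q n\<close> have matching inner dimensions \<open>n p r\<close> and \<open>q n r\<close>. Hence any
  three classes have representatives that can be multiplied as ordinary matrices
  (\<open>conformable_representatives\<close>), and since the product of classes does not depend on
  representatives, its associativity is that of matrix multiplication. The identity is the class of
  the \<open>1 \<times> 1\<close> identity matrix, which consists of the identity matrices of all orders.
\<close>

lemma M_class_eq: "(A, B) \<in> M_equiv \<Longrightarrow> M_class A = M_class B"
  unfolding M_class_def by (rule equiv_class_eq [OF M_equiv_equiv])

lemma M_class_in_Sigma: "A \<in> M_mats \<Longrightarrow> M_class A \<in> Sigma_M"
  unfolding M_class_def Sigma_M_def by (rule quotientI)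

lemma Sigma_cases:
  assumes "X \<in> Sigma_M"
  obtains A where "A \<in> M_mats" "X = M_class A"
  using assms unfolding Sigma_M_def M_class_def by (rule quotientE)

lemma M_class_kron_one:
  assumes "A \<in> M_mats" "0 < a"
  shows "M_class (A \<otimes>\<^sub>K 1\<^sub>m a) = M_class A"
  using assms
  by (intro M_class_eq M_equivI [where a = 1 and b = a] M_mats_kron_one) (simp_all only: kron_one_1)

lemma M_prod_conformable:
  assumes "dim_col A = dim_row B" "0 < dim_row B"
  shows "A \<times>\<^sub>M B = A * B"
  using assms kron_one_1 by (simp add: M_prod_def)

text \<open>
  The middle matrix is enlarged only once, so a single order must match it on both sides. The choice
  \<open>n r\<close> makes its row dimension a multiple of \<open>n\<close> and its column dimension a multiple of \<open>r\<close>,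
  and these two conditions determine the orders for the outer matrices.
\<close>

lemma conformable_representatives:
  assumes "X \<in> Sigma_M" "Y \<in> Sigma_M" "Z \<in> Sigma_M"
  obtains A B C where "A \<in> M_mats" "B \<in> M_mats" "C \<in> M_mats"
    "X = M_class A" "Y = M_class B" "Z = M_class C"
    "dim_col A = dim_row B" "dim_col B = dim_row C"
proof -
  obtain A where A: "A \<in> M_mats" "X = M_class A" using assms(1) by (rule Sigma_cases)
  obtain B where B: "B \<in> M_mats" "Y = M_class B" using assms(2) by (rule Sigma_cases)
  obtain C where C: "C \<in> M_mats" "Z = M_class C" using assms(3) by (rule Sigma_cases)
  define a where "a = dim_row B * dim_row C"
  define b where "b = dim_col A * dim_row C"
  define c where "c = dim_col B * dim_col A"
  have pos: "0 < a" "0 < b" "0 < c"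
    using A B C by (simp_all add: a_def b_def c_def M_mats_iff)
  show ?thesis
  proof (rule that)
    show "A \<otimes>\<^sub>K 1\<^sub>m a \<in> M_mats" "B \<otimes>\<^sub>K 1\<^sub>m b \<in> M_mats" "C \<otimes>\<^sub>K 1\<^sub>m c \<in> M_mats"
      using A B C pos by (simp_all add: M_mats_kron_one)
    show "X = M_class (A \<otimes>\<^sub>K 1\<^sub>m a)" "Y = M_class (B \<otimes>\<^sub>K 1\<^sub>m b)" "Z = M_class (C \<otimes>\<^sub>K 1\<^sub>m c)"
      using A B C pos by (simp_all add: M_class_kron_one)
    show "dim_col (A \<otimes>\<^sub>K 1\<^sub>m a) = dim_row (B \<otimes>\<^sub>K 1\<^sub>m b)"
      "dim_col (B \<otimes>\<^sub>K 1\<^sub>m b) = dim_row (C \<otimes>\<^sub>K 1\<^sub>m c)"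
      by (simp_all add: a_def b_def c_def)
  qed
qed

lemma M_class_prod_assoc:
  assumes "X \<in> Sigma_M" "Y \<in> Sigma_M" "Z \<in> Sigma_M"
  shows "M_class_prod (M_class_prod X Y) Z = M_class_prod X (M_class_prod Y Z)"
proof -
  obtain A B C where mats: "A \<in> M_mats" "B \<in> M_mats" "C \<in> M_mats"
    and cls: "X = M_class A" "Y = M_class B" "Z = M_class C"
    and dims: "dim_col A = dim_row B" "dim_col B = dim_row C"
    using assms by (rule conformable_representatives)
  have "0 < dim_row B" "0 < dim_row C" using mats by (simp_all add: M_mats_iff)
  with dims have "A \<times>\<^sub>M B \<times>\<^sub>M C = A * B * C" "A \<times>\<^sub>M (B \<times>\<^sub>M C) = A * (B * C)"
    by (simp_all add: M_prod_conformable)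
  moreover have "A * B * C = A * (B * C)"
    using dims by (intro assoc_mult_mat [of A "dim_row A" "dim_col A" B "dim_col B" C "dim_col C"]) auto
  ultimately show ?thesis
    using mats by (simp add: cls M_class_prod_eq M_prod_closed)
qed

lemma M_prod_one_left: "A \<in> M_mats \<Longrightarrow> 1\<^sub>m 1 \<times>\<^sub>M A = A"
  using kron_one_one [of 1 "dim_row A"] kron_one_1 [of A]
  by (simp add: M_prod_def M_mats_iff)

lemma M_prod_one_right: "A \<in> M_mats \<Longrightarrow> A \<times>\<^sub>M 1\<^sub>m 1 = A"
  using kron_one_one [of 1 "dim_col A"] kron_one_1 [of A]
  by (simp add: M_prod_def M_mats_iff)

theorem mainTheorem6:
  shows "\<exists>e. monoid \<lparr>carrier = Sigma_M, mult = M_class_prod, one = e\<rparr>"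
proof (intro exI monoidI, simp_all only: partial_object.simps monoid.simps)
  have one: "1\<^sub>m 1 \<in> M_mats" by (simp add: M_mats_iff)
  then show "M_class (1\<^sub>m 1) \<in> Sigma_M" by (rule M_class_in_Sigma)
  show "M_class_prod X Y \<in> Sigma_M" if "X \<in> Sigma_M" "Y \<in> Sigma_M" for X Y
    using that by (auto elim!: Sigma_cases simp: M_class_prod_eq M_prod_closed M_class_in_Sigma)
  show "M_class_prod (M_class_prod X Y) Z = M_class_prod X (M_class_prod Y Z)"
    if "X \<in> Sigma_M" "Y \<in> Sigma_M" "Z \<in> Sigma_M" for X Y Z
    using that by (rule M_class_prod_assoc)
  show "M_class_prod (M_class (1\<^sub>m 1)) X = X" if "X \<in> Sigma_M" for X
    using that by (rule Sigma_cases) (simp only: M_class_prod_eq one M_prod_one_left)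
  show "M_class_prod X (M_class (1\<^sub>m 1)) = X" if "X \<in> Sigma_M" for X
    using that by (rule Sigma_cases) (simp only: M_class_prod_eq one M_prod_one_right)
qed

end
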